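(* Let $\gamma\colon(-1,1)\to\mathbb{C}$ be an initial curve of $F$, let $H=I_F(\gamma)$ be its initial region, and let $d\in H$. Let $\alpha$ be a holomorphic function on $H$ that is an Abel function of $F$ on $H$, i.e. $\alpha(F(z))=\alpha(z)+1$ for all $z\in H\cap F^{-1}(H)$, with $\alpha(d)=0$. Suppose that the real function $f(t)=\operatorname{Im}(\alpha(\gamma(t)))$, $t\in(-1,1)$, is strictly increasing and $\lim_{t\to\pm1}f(t)=\pm\infty$ (i.e. $+\infty$ as $t\to1$ and $-\infty$ as $t\to-1$). Then the curve $\zeta=\alpha\circ\gamma$ is injective, $\zeta\cap(\zeta+1)=\emptyset$, and $\lim_{t\to\pm1}\operatorname{Im}(\zeta(t))=\pm\infty$.
   Context: Conventions: a curve is a continuous map on the open interval $(-1,1)$; in set contexts a curve stands for its image. For $A\subseteq\mathbb{C}$ and $z\in\mathbb{C}$, $A+z=\{a+z: a\in A\}$. A function is holomorphic on a (not necessarily open) set if each point of the set has a neighborhood on which the function is holomorphic. $\uplus$ denotes disjoint union. Initial curve: let $F$ be a complex function. A curve $\gamma\colon(-1,1)\to\mathbb{C}$ on which $F$ is holomorphic is an initial curve of $F$ if $\gamma$ and $F\circ\gamma$ are injective and their images are disjoint, and the limits $\gamma(\pm1):=\lim_{t\to\pm1}\gamma(t)$ exist, satisfy $\gamma(-1)\neq\gamma(1)$, and are two fixed points of $F$. It is understood that then $F(\gamma(t))\to\gamma(\pm1)$ as $t\to\pm1$ and that $\gamma\cup(F\circ\gamma)\cup\{\gamma(-1),\gamma(1)\}$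 is a closed Jordan curve. Initial region: with $C$ the inner (bounded) component of the complement of this Jordan curve, the initial region of $\gamma$ is $I_F(\gamma):=\gamma\uplus C\uplus F(\gamma)=\overline{C}\setminus\{\gamma(-1),\gamma(1)\}$. *)

theory Defs
  imports "HOL-Analysis.Analysis"
begin

text \<open>
  A complex function \<open>F\<close> with domain \<open>D\<close> is represented by a total function together with
  the set \<open>D\<close>; the values of \<open>F\<close> outside \<open>D\<close> play no role. Likewise a curve is a function on
  the reals of which only the restriction to \<open>(-1,1)\<close> matters.
  The library predicate \<open>analytic_on\<close> is holomorphy in a neighbourhood of each point of a set
  (not necessarily open).
\<close>

abbreviation param_interval :: "real set" where
  "param_interval \<equiv> {-1<..<1}"

definition curve :: "(real \<Rightarrow> complex) \<Rightarrow> bool" where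
  "curve \<gamma> \<longleftrightarrow> continuous_on param_interval \<gamma>"

abbreviation curve_image :: "(real \<Rightarrow> complex) \<Rightarrow> complex set" where
  "curve_image \<gamma> \<equiv> \<gamma> ` param_interval"

definition left_end :: "(real \<Rightarrow> complex) \<Rightarrow> complex" where
  "left_end \<gamma> = Lim (at_right (-1)) \<gamma>"

definition right_end :: "(real \<Rightarrow> complex) \<Rightarrow> complex" where
  "right_end \<gamma> = Lim (at_left 1) \<gamma>"

definition holomorphic_fun_on :: "(complex \<Rightarrow> complex) \<Rightarrow> complex set \<Rightarrow> complex set \<Rightarrow> bool" where
  "holomorphic_fun_on F D A \<longleftrightarrow> A \<subseteq> interior D \<and> F analytic_on A"

definition fixed_point :: "(complex \<Rightarrow> complex) \<Rightarrow> complex set \<Rightarrow> complex \<Rightarrow> bool" where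
  "fixed_point F D p \<longleftrightarrow> p \<in> D \<and> F p = p"

definition closed_jordan_curve :: "complex set \<Rightarrow> bool" where
  "closed_jordan_curve J \<longleftrightarrow>
     (\<exists>c. simple_path c \<and> pathfinish c = pathstart c \<and> path_image c = J)"

definition initial_boundary :: "(complex \<Rightarrow> complex) \<Rightarrow> (real \<Rightarrow> complex) \<Rightarrow> complex set" where
  "initial_boundary F \<gamma> =
     curve_image \<gamma> \<union> curve_image (F \<circ> \<gamma>) \<union> {left_end \<gamma>, right_end \<gamma>}"

text \<open>
  The last three conjuncts do not follow from the others: \<open>F\<close> need not be continuous at the
  end points of \<open>\<gamma>\<close>, and \<open>F \<circ> \<gamma>\<close> might pass through one of them. They are the understood part of
  the notion, and without them the inner component would not make sense.
\<close>

definition initial_curve ::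
  "(complex \<Rightarrow> complex) \<Rightarrow> complex set \<Rightarrow> (real \<Rightarrow> complex) \<Rightarrow> bool" where
  "initial_curve F D \<gamma> \<longleftrightarrow>
     curve \<gamma> \<and>
     holomorphic_fun_on F D (curve_image \<gamma>) \<and>
     inj_on \<gamma> param_interval \<and>
     inj_on (F \<circ> \<gamma>) param_interval \<and>
     curve_image \<gamma> \<inter> curve_image (F \<circ> \<gamma>) = {} \<and>
     (\<gamma> \<longlongrightarrow> left_end \<gamma>) (at_right (-1)) \<and>
     (\<gamma> \<longlongrightarrow> right_end \<gamma>) (at_left 1) \<and>
     left_end \<gamma> \<noteq> right_end \<gamma> \<and>
     fixed_point F D (left_end \<gamma>) \<and>
     fixed_point F D (right_end \<gamma>) \<and>
     ((F \<circ> \<gamma>) \<longlongrightarrow> left_end \<gamma>) (at_right (-1)) \<and>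
     ((F \<circ> \<gamma>) \<longlongrightarrow> right_end \<gamma>) (at_left 1) \<and>
     closed_jordan_curve (initial_boundary F \<gamma>)"

text \<open>
  \<open>inside J\<close> is the union of the bounded components of the complement of \<open>J\<close>; for a closed Jordan
  curve there is exactly one.
\<close>

definition initial_region :: "(complex \<Rightarrow> complex) \<Rightarrow> (real \<Rightarrow> complex) \<Rightarrow> complex set" where
  "initial_region F \<gamma> =
     curve_image \<gamma> \<union> inside (initial_boundary F \<gamma>) \<union> curve_image (F \<circ> \<gamma>)"

definition abel_function_on ::
  "(complex \<Rightarrow> complex) \<Rightarrow> (complex \<Rightarrow> complex) \<Rightarrow> complex set \<Rightarrow> complex set \<Rightarrow> bool" where
  "abel_function_on \<alpha> F D H \<longleftrightarrow> (\<forall>z \<in> H \<inter> {z \<in> D. F z \<in> H}. \<alpha> (F z) = \<alpha> z + 1)"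

end

theory Submission
  imports Defs
begin

text \<open>The imaginary part of \<open>\<zeta>\<close> is \<open>f\<close>, which is injective
  because it is strictly increasing, so the height of a point of \<open>\<zeta>\<close> determines
  its parameter. This gives injectivity of \<open>\<zeta>\<close>. The shift by 1 is horizontal and
  preserves heights, so a common point of \<open>\<zeta>\<close> and its translate would come from a
  single parameter t with \<open>\<zeta> t = \<zeta> t + 1\<close>, which is absurd. The limits are
  those of \<open>f\<close>.\<close>

theorem mainTheorem5:
  fixes F \<alpha> :: "complex \<Rightarrow> complex"
    and D H :: "complex set"
    and \<gamma> \<zeta> :: "real \<Rightarrow> complex"
    and d :: complex
    and f :: "real \<Rightarrow> real"
  assumes "initial_curve F D \<gamma>"
    and "H = initial_region F \<gamma>"
    and "d \<in> H"
    and "\<alpha> analytic_on H"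
    and "abel_function_on \<alpha> F D H"
    and "\<alpha> d = 0"
    and "f = (\<lambda>t. Im (\<alpha> (\<gamma> t)))"
    and "strict_mono_on {-1<..<1} f"
    and "filterlim f at_top (at_left 1)"
    and "filterlim f at_bot (at_right (-1))"
    and "\<zeta> = \<alpha> \<circ> \<gamma>"
  shows "curve \<zeta> \<and>
         inj_on \<zeta> {-1<..<1} \<and>
         curve_image \<zeta> \<inter> (\<lambda>z. z + 1) ` curve_image \<zeta> = {} \<and>
         filterlim (\<lambda>t. Im (\<zeta> t)) at_top (at_left 1) \<and>
         filterlim (\<lambda>t. Im (\<zeta> t)) at_bot (at_right (-1))"
proof -
  have im: "Im (\<zeta> t) = f t" for t
    using assms(7,11) by simp
  have inj: "inj_on f {-1<..<1}"
    using assms(8) by (rule strict_mono_on_imp_inj_on)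
  \<comment> \<open>The image of \<open>\<gamma>\<close> is part of the initial region, where
    \<open>\<alpha>\<close> is analytic; this yields the continuity required by
    \<open>curve \<zeta>\<close>.\<close>
  have "continuous_on (curve_image \<gamma>) \<alpha>"
    using assms(2,4) unfolding initial_region_def
    by (intro holomorphic_on_imp_continuous_on analytic_imp_holomorphic)
      (auto intro: analytic_on_subset)
  then have "curve \<zeta>"
    using assms(1,11) unfolding initial_curve_def curve_def
    by (simp add: continuous_on_compose del: o_apply)
  moreover have "inj_on \<zeta> {-1<..<1}"
    using inj im by (metis inj_on_def)
  moreover have "\<zeta> s \<noteq> \<zeta> t + 1" if "s \<in> {-1<..<1}" "t \<in> {-1<..<1}" for s t
  proof
    assume eq: "\<zeta> s = \<zeta> t + 1"
    \<comment> \<open>Taking imaginary parts removes the real summand 1.\<close>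
    then have "f s = f t"
      by (simp flip: im)
    then have "s = t"
      using inj that by (auto dest: inj_onD)
    with eq show False
      by simp
  qed
  then have "curve_image \<zeta> \<inter> (\<lambda>z. z + 1) ` curve_image \<zeta> = {}"
    by blast
  ultimately show ?thesis
    using assms(9,10) im by simp
qed

end
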